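(* Let $a\neq b$ be coprime positive integers, $A=\{a,b\}$ and $A'=\{1,a+b-1\}$. For a binary string $Y=Y(0)\cdots Y(a+b-1)$ of length $a+b$, let $X=\sigma_{a,a+b}(Y)$ be the string of length $a+b$ with $X(n)=Y(an \bmod (a+b))$ for $n=0,\ldots,a+b-1$. Then $Y^\infty\in\mathcal W^A$ if and only if $X^\infty\in\mathcal W^{A'}$.
   Context: For a finite nonempty set $A$ of positive integers let $\alpha=\max A$. For a seed $S=s_1\cdots s_\alpha\in\{0,1\}^\alpha$, define $w^{A,S}(-\alpha-1+j)=s_j$ for $j=1,\ldots,\alpha$ and $w^{A,S}(n)=1-\min\{w^{A,S}(n-x):x\in A\}$ for $n\ge0$. $\mathcal W^A=\{(w^{A,S}(n))_{n\ge0}: S\in\{0,1\}^\alpha\}$. $Y^\infty$ is the infinite word $YYY\cdots$ indexed from $0$. *)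

theory Defs
  imports Complex_Main
begin

text \<open>
  The sequence \<open>w\<close> lives on the integers \<open>n \<ge> -\<alpha>\<close>, where \<open>\<alpha> = Max A\<close>. The seed
  \<open>s\<^sub>1 \<dots> s\<^sub>\<alpha>\<close> is a list, so that \<open>s\<^sub>j = S ! (j - 1)\<close>, and \<open>w (-\<alpha> - 1 + j) = s\<^sub>j\<close> reads
  \<open>w n = S ! (n + \<alpha>)\<close> for \<open>-\<alpha> \<le> n < 0\<close>. The values at \<open>n < -\<alpha>\<close> are irrelevant (never reached
  from \<open>n \<ge> 0\<close>). Removing 0 from \<open>A\<close> only serves termination; it is vacuous for sets of
  positive integers. Letters are the naturals 0 and 1.
\<close>

function wseq :: "nat set \<Rightarrow> nat list \<Rightarrow> int \<Rightarrow> nat" where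
  "wseq A S n =
     (if n < 0 then S ! nat (n + int (Max A))
      else 1 - Min ((\<lambda>x. wseq A S (n - int x)) ` (A - {0})))"
  by pat_completeness auto
termination
  by (relation "measure (\<lambda>(A, S, n). nat (n + 1))") auto

declare wseq.simps [simp del]

definition binary_string :: "nat \<Rightarrow> nat list \<Rightarrow> bool" where
  "binary_string m S \<longleftrightarrow> length S = m \<and> set S \<subseteq> {0, 1}"

definition wset :: "nat set \<Rightarrow> (nat \<Rightarrow> nat) set" where
  "wset A = {(\<lambda>n. wseq A S (int n)) | S. binary_string (Max A) S}"

definition omega_power :: "nat list \<Rightarrow> nat \<Rightarrow> nat" where
  "omega_power Y n = Y ! (n mod length Y)"

definition sigma :: "nat \<Rightarrow> nat \<Rightarrow> nat list \<Rightarrow> nat list" where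
  "sigma a m Y = map (\<lambda>n. Y ! (a * n mod m)) [0..<m]"

end

theory Submission
  imports Defs "HOL-Number_Theory.Cong"
begin

text \<open>
  A periodic word belongs to \<open>\<W>\<^sup>A\<close> iff its extension to a periodic word on all integers satisfies
  the recurrence everywhere. For period \<open>m = a + b\<close> we have \<open>-b \<equiv> a\<close> modulo \<open>m\<close>, so the recurrence
  reads \<open>y n = 1 - min (y (n - a)) (y (n + a))\<close>. Multiplication by the unit \<open>a\<close> modulo \<open>m\<close> carries
  this to \<open>x k = 1 - min (x (k - 1)) (x (k + 1))\<close>, which is the recurrence of \<open>{1, m - 1}\<close>.
\<close>

text \<open>Integer indices keep subtraction from truncating, so the recurrence can be stated at
  every position, without a boundary.\<close>

definition cyclic_nth :: "'a list \<Rightarrow> int \<Rightarrow> 'a" where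
  "cyclic_nth Y n = Y ! nat (n mod int (length Y))"

lemma cyclic_nth_cong:
  assumes "[m = n] (mod int (length Y))"
  shows "cyclic_nth Y m = cyclic_nth Y n"
  using assms by (simp add: cyclic_nth_def cong_def)

lemma cyclic_nth_of_nat: "cyclic_nth Y (int n) = omega_power Y n"
  by (simp add: cyclic_nth_def omega_power_def nat_mod_distrib)

lemma cyclic_nth_in_set: "Y \<noteq> [] \<Longrightarrow> cyclic_nth Y n \<in> set Y"
  unfolding cyclic_nth_def by (intro nth_mem) (simp add: nat_less_iff)

lemma wseq_pair:
  assumes "a > 0" "b > 0" "n \<ge> 0"
  shows "wseq {a, b} S n = 1 - min (wseq {a, b} S (n - int a)) (wseq {a, b} S (n - int b))"
proof -
  have "{a, b} - {0} = {a, b}" using assms by auto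
  then show ?thesis using assms(3) by (subst wseq.simps) simp
qed

text \<open>Forwards, the recurrence is known only at nonnegative positions, and periodicity carries
  it to all others. Backwards, the letters of the periodic extension just before position 0 serve as
  the seed.\<close>

lemma omega_power_in_wset_pair_iff:
  assumes "a > 0" "b > 0" "Y \<noteq> []" "set Y \<subseteq> {0, 1}"
  shows "omega_power Y \<in> wset {a, b} \<longleftrightarrow>
    (\<forall>n. cyclic_nth Y n = 1 - min (cyclic_nth Y (n - int a)) (cyclic_nth Y (n - int b)))"
    (is "?L \<longleftrightarrow> ?R")
proof
  assume ?L
  then obtain S where "omega_power Y = (\<lambda>n. wseq {a, b} S (int n))"
    by (auto simp: wset_def)
  then have w: "wseq {a, b} S n = cyclic_nth Y n" if "n \<ge> 0" for n
    using that by (metis cyclic_nth_of_nat nonneg_int_cases)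
  show ?R
  proof
    fix n
    \<comment> \<open>A shift of \<open>n\<close> by a multiple of the period, large enough that
      \<open>N - a\<close> and \<open>N - b\<close> are nonnegative. The seed, which need not agree
      with the periodic extension, is thus never read.\<close>
    define N where "N = n + (\<bar>n\<bar> + int a + int b) * int (length Y)"
    have "(\<bar>n\<bar> + int a + int b) * 1 \<le> (\<bar>n\<bar> + int a + int b) * int (length Y)"
      using assms(3) by (intro mult_left_mono) (auto simp: Suc_le_eq)
    then have N: "N \<ge> int a" "N \<ge> int b" unfolding N_def by auto
    have shift: "cyclic_nth Y (N - c) = cyclic_nth Y (n - c)" for c
      by (rule cyclic_nth_cong) (simp add: N_def cong_iff_dvd_diff)
    have "cyclic_nth Y N = 1 - min (cyclic_nth Y (N - int a)) (cyclic_nth Y (N - int b))"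
      using wseq_pair[OF assms(1,2), of N S] N by (simp add: w)
    then show "cyclic_nth Y n = 1 - min (cyclic_nth Y (n - int a)) (cyclic_nth Y (n - int b))"
      using shift[of 0] by (simp add: shift)
  qed
next
  assume R: ?R
  define M where "M = Max {a, b}"
  \<comment> \<open>The window of the periodic extension on the positions from \<open>-M\<close> to
    \<open>-1\<close>.\<close>
  define S where "S = map (\<lambda>j. cyclic_nth Y (int j - int M)) [0..<M]"
  have M: "a \<le> M" "b \<le> M" by (auto simp: M_def)
  have "set S \<subseteq> set Y"
    using cyclic_nth_in_set[OF assms(3)] by (auto simp: S_def)
  then have S: "binary_string M S"
    using assms(4) by (auto simp: binary_string_def S_def)
  have w: "wseq {a, b} S n = cyclic_nth Y n" if "n \<ge> - int M" for n
    using that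
  \<comment> \<open>The measure is the distance from the left end of the seed. For
    \<open>n \<ge> 0\<close>, the bounds \<open>a \<le> M\<close> and \<open>b \<le> M\<close> keep
    both predecessors at or above \<open>-M\<close>.\<close>
  proof (induction "nat (n + int M)" arbitrary: n rule: less_induct)
    case less
    show ?case
    proof (cases "n < 0")
      case True
      then have "wseq {a, b} S n = S ! nat (n + int M)"
        by (subst wseq.simps) (simp add: M_def)
      also have "\<dots> = cyclic_nth Y n"
      proof -
        have "nat (n + int M) < M" using True less.prems by linarith
        then show ?thesis using less.prems by (simp add: S_def)
      qed
      finally show ?thesis .
    next
      case False
      then have "wseq {a, b} S (n - int c) = cyclic_nth Y (n - int c)" if "c > 0" "c \<le> M" for c
        using that by (intro less.hyps) auto
      then show ?thesis
        using wseq_pair[OF assms(1,2), of n S] R[rule_format, of n] False assms(1,2) M by simp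
    qed
  qed
  have "omega_power Y = (\<lambda>n. wseq {a, b} S (int n))"
    by (simp add: fun_eq_iff w cyclic_nth_of_nat)
  then show ?L using S by (auto simp: wset_def M_def)
qed

text \<open>Replacing \<open>k\<close> by its residue modulo \<open>m\<close> changes
  \<open>a * k\<close> by a multiple of \<open>m\<close> only, so the formula defining
  \<open>sigma\<close> on \<open>[0..<m]\<close> extends to all integers.\<close>

lemma cyclic_nth_sigma:
  assumes "length Y = m" "m > 0"
  shows "cyclic_nth (sigma a m Y) k = cyclic_nth Y (int a * k)"
proof -
  define r where "r = nat (k mod int m)"
  have r: "int r = k mod int m" "r < m"
    using assms(2) by (auto simp: r_def nat_less_iff)
  have "cyclic_nth (sigma a m Y) k = Y ! (a * r mod m)"
    using r(2) by (simp add: cyclic_nth_def sigma_def flip: r_def)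
  also have "\<dots> = cyclic_nth Y (int (a * r))"
    by (simp only: cyclic_nth_of_nat omega_power_def assms(1))
  also have "\<dots> = cyclic_nth Y (int a * k)"
    by (rule cyclic_nth_cong) (simp add: assms(1) r(1) cong_def mod_mult_right_eq)
  finally show ?thesis .
qed

theorem theorem3p13:
  fixes a b :: nat and Y :: "nat list"
  assumes "a > 0" and "b > 0" and "a \<noteq> b" and "coprime a b"
    and "binary_string (a + b) Y"
  shows "omega_power Y \<in> wset {a, b} \<longleftrightarrow>
         omega_power (sigma a (a + b) Y) \<in> wset {1, a + b - 1}"
proof -
  define m where "m = a + b"
  define X where "X = sigma a m Y"
  define y where "y = cyclic_nth Y"
  have m: "m > 0" "m - 1 > 0" "int b = int m - int a" "int (m - 1) = int m - 1"
    using assms(1,2) by (auto simp: m_def)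
  have Y: "length Y = m" "Y \<noteq> []" "set Y \<subseteq> {0, 1}"
    using assms(5) m by (auto simp: binary_string_def m_def)
  have "set X \<subseteq> set Y"
    using m(1) Y(1) by (auto simp: X_def sigma_def)
  then have X: "X \<noteq> []" "set X \<subseteq> {0, 1}"
    using Y m(1) by (auto simp: X_def sigma_def)
  have y_cong: "y k = y l" if "[k = l] (mod int m)" for k l
    using that Y(1) by (auto simp: y_def intro: cyclic_nth_cong)
  have x: "cyclic_nth X k = y (int a * k)" for k
    using cyclic_nth_sigma[OF Y(1) m(1)] by (simp add: X_def y_def)
  let ?P = "\<lambda>n. y n = 1 - min (y (n - int a)) (y (n + int a))"
  have "omega_power Y \<in> wset {a, b} \<longleftrightarrow> (\<forall>n. ?P n)"
  proof -
    have "y (n - int b) = y (n + int a)" for n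
      by (rule y_cong) (simp add: m(3) cong_iff_dvd_diff)
    then show ?thesis
      using omega_power_in_wset_pair_iff[OF assms(1,2) Y(2,3)] by (simp add: y_def)
  qed
  also have "(\<forall>n. ?P n) \<longleftrightarrow> (\<forall>k. ?P (int a * k))"
  proof (intro iffI allI)
    fix n
    assume *: "\<forall>k. ?P (int a * k)"
    \<comment> \<open>Since \<open>gcd a (a + b) = gcd a b = 1\<close>, there is an inverse
      \<open>c\<close> of \<open>a\<close> modulo \<open>m\<close>. Every \<open>n\<close> is then
      congruent to the multiple \<open>a * (c * n)\<close> of \<open>a\<close>.\<close>
    have "coprime (int a) (int m)"
      unfolding m_def coprime_int_iff using assms(4) by (metis coprime_iff_gcd_eq_1 gcd_add2)
    then obtain c where "[int a * c = 1] (mod int m)"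
      using cong_solve_coprime_int by blast
    then have "[int a * c * n = 1 * n] (mod int m)"
      by (rule cong_mult) simp
    then have eq: "[int a * (c * n) = n] (mod int m)"
      by (simp add: mult.assoc)
    have "y (int a * (c * n)) = y n" "y (int a * (c * n) - int a) = y (n - int a)"
      "y (int a * (c * n) + int a) = y (n + int a)"
      using eq by (auto intro!: y_cong cong_diff cong_add)
    with * show "?P n" by metis
  qed blast
  also have "\<dots> \<longleftrightarrow> omega_power X \<in> wset {1, m - 1}"
  proof -
    \<comment> \<open>The two arguments differ by \<open>a * m\<close>: stepping back by
      \<open>m - 1\<close> is stepping forward by 1 modulo \<open>m\<close>.\<close>
    have "y (int a * (k - int (m - 1))) = y (int a * k + int a)" for k
      unfolding m(4) by (rule y_cong) (simp add: cong_iff_dvd_diff algebra_simps)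
    moreover have "y (int a * (k - int 1)) = y (int a * k - int a)" for k
      by (simp add: algebra_simps)
    ultimately show ?thesis
      by (simp only: omega_power_in_wset_pair_iff[OF zero_less_one m(2) X] x)
  qed
  finally show ?thesis by (simp only: X_def m_def)
qed

end
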